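(* Let $\mu^\infty$ be the product probability measure on $\{0,1\}^\infty$ described in the context. For $\mu^\infty$-almost every $\mathcal S\in\{0,1\}^\infty$ (i.e. with probability $1$ for a random sequence $\mathcal S$) there is a constant $C>0$ (which may depend on $\mathcal S$) such that for all integers $N\ge 2$ $$\left|\lambda_{\mathcal S}(N)-\frac N2\right|\le C\log N\qquad\text{and}\qquad 2^{\frac N2-C\log N}\le\Lambda_{\mathcal S}(N)\le 2^{\frac N2+C\log N},$$ that is, $\lambda_{\mathcal S}(N)=\frac N2+O(\log N)$ and $\Lambda_{\mathcal S}(N)=2^{\frac N2+O(\log N)}$ for all $N$.
   Context: For an infinite binary sequence $\mathcal S=(s_i)_{i\ge0}\in\{0,1\}^\infty$ and an integer $N\ge1$, the $N$th rational complexity is $$\Lambda_{\mathcal S}(N)=\min\left\{\max\{|f|,q\}: f,q\in\mathbb Z,\ q>0\text{ odd},\ q\sum_{i=0}^{N-1}s_i2^i\equiv f \bmod 2^N\right\},$$ and the $N$th $2$-adic complexity is $\lambda_{\mathcal S}(N)=\log_2\Lambda_{\mathcal S}(N)$. Let $\mu$ be the uniform probability measure on $\{0,1\}$ (each element has measure $\frac12$), and let $\mu^\infty$ be the complete product measure it induces on the set $\{0,1\}^\infty$ of infinite binary sequences. Here $\log$ is the natural logarithm. *)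

theory Defs
  imports "HOL-Probability.Probability" "HOL-Number_Theory.Cong"
begin

definition admissible_fraction :: "(nat \<Rightarrow> nat) \<Rightarrow> nat \<Rightarrow> int \<Rightarrow> int \<Rightarrow> bool" where
  "admissible_fraction S N f q \<longleftrightarrow>
     q > 0 \<and> odd q \<and> [q * (\<Sum>i<N. int (S i) * 2 ^ i) = f] (mod 2 ^ N)"

text \<open>
  The minimum ranges over an infinite set of integers, so it is taken with \<open>LEAST\<close>
  (\<open>Min\<close> is unspecified on infinite sets).  See \<open>rational_complexity_le\<close> and
  \<open>rational_complexity_attained\<close> below.
\<close>

definition rational_complexity :: "(nat \<Rightarrow> nat) \<Rightarrow> nat \<Rightarrow> int" where
  "rational_complexity S N = (LEAST m. \<exists>f q. admissible_fraction S N f q \<and> m = max \<bar>f\<bar> q)"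

definition two_adic_complexity :: "(nat \<Rightarrow> nat) \<Rightarrow> nat \<Rightarrow> real" where
  "two_adic_complexity S N = log 2 (real_of_int (rational_complexity S N))"

definition binary_sequence_measure :: "(nat \<Rightarrow> nat) measure" where
  "binary_sequence_measure =
     completion (PiM (UNIV :: nat set) (\<lambda>_. uniform_count_measure {0, 1 :: nat}))"

lemma space_binary_sequence_measure:
  "space binary_sequence_measure = {S. \<forall>i. S i \<in> {0, 1}}"
  by (auto simp: binary_sequence_measure_def space_PiM space_uniform_count_measure PiE_def Pi_def)

lemma rational_complexity_le:
  assumes "admissible_fraction S N f q"
  shows "rational_complexity S N \<le> max \<bar>f\<bar> q"
    and "\<exists>f q. admissible_fraction S N f q \<and> rational_complexity S N = max \<bar>f\<bar> q"
proof -
  define P where "P m \<longleftrightarrow> (\<exists>f q. admissible_fraction S N f q \<and> m = max \<bar>f\<bar> q)" for m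
  define k where "k = (LEAST k. P (int k))"
  have nonneg: "0 \<le> m" if "P m" for m
    using that by (auto simp: P_def)
  have P: "P (max \<bar>f\<bar> q)"
    using assms by (auto simp: P_def)
  then have "P (int (nat (max \<bar>f\<bar> q)))"
    using nonneg[OF P] by (simp only: int_nat_eq if_True)
  then have k: "P (int k)"
    unfolding k_def by (rule LeastI)
  have min: "int k \<le> m" if "P m" for m
  proof -
    have "P (int (nat m))"
      using that nonneg[OF that] by simp
    then have "k \<le> nat m"
      unfolding k_def by (rule Least_le)
    then show ?thesis
      using nonneg[OF that] by linarith
  qed
  have "(LEAST m. P m) = int k"
    using k min by (rule Least_equality)
  then have eq: "rational_complexity S N = int k"
    by (simp add: rational_complexity_def P_def)
  show "rational_complexity S N \<le> max \<bar>f\<bar> q"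
    using min[OF P] eq by simp
  show "\<exists>f q. admissible_fraction S N f q \<and> rational_complexity S N = max \<bar>f\<bar> q"
    using k eq by (simp add: P_def)
qed

lemma rational_complexity_attained:
  obtains f q where "admissible_fraction S N f q" "rational_complexity S N = max \<bar>f\<bar> q"
proof -
  have "admissible_fraction S N (\<Sum>i<N. int (S i) * 2 ^ i) 1"
    by (simp add: admissible_fraction_def)
  from rational_complexity_le(2)[OF this] that show thesis
    by blast
qed

end

theory Submission
  imports Defs
begin

text \<open>
  Write \<open>s\<close> for the integer encoded by the first \<open>N\<close> bits and \<open>\<Lambda>(N)\<close> for the rational
  complexity.  The proof has a probabilistic half, which bounds \<open>\<Lambda>\<close> from below, and a
  deterministic half, which turns lower bounds for all lengths up to \<open>N\<close> into an upper bound for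
  \<open>\<Lambda>(N)\<close>.

  \<^emph>\<open>Lower bound.\<close>  As \<open>q\<close> is odd, a pair \<open>(f, q)\<close> determines \<open>s\<close> modulo \<open>2 ^ N\<close>, so it is
  admissible with probability at most \<open>2 ^ -N\<close>.  At most \<open>3 * K\<^sup>2\<close> pairs compete for
  \<open>\<Lambda>(N) \<le> K\<close>.  With \<open>K = 2 powr (N / 2) / N\<close> the probability is at most \<open>3 / N\<^sup>2\<close>, which is
  summable, and the Borel-Cantelli lemma (\<open>AE_eventually_complexity_large\<close>) gives
  \<open>\<Lambda>(N) > K\<close> for all large \<open>N\<close>, almost surely.

  \<^emph>\<open>Upper bound.\<close>  There is no upper bound of the right order for every sequence: short vectors
  of the lattice of all \<open>(f, q)\<close> with \<open>q * s \<equiv> f\<close> modulo \<open>2 ^ N\<close> may all have \<open>q\<close> even (for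
  \<open>s = 2 ^ (N - 1)\<close> the complexity is \<open>2 ^ (N - 1)\<close>).  But a vector with \<open>q\<close> even can be halved,
  giving a vector for length \<open>N - 1\<close>; repeating this until \<open>q\<close> is odd or the length is \<open>0\<close> shows that lower bounds
  \<open>\<Lambda>(n) \<ge> h * 2 powr (n / 2)\<close> for all \<open>n \<le> N\<close> force \<^emph>\<open>every\<close> lattice vector with \<open>q > 0\<close> to have
  size at least \<open>h * 2 powr (N / 2)\<close> (\<open>fraction_lower_bound\<close>).  Now run the Euclidean algorithm on
  \<open>2 ^ N\<close> and \<open>s\<close>.  Remainders and cofactors are lattice vectors; two consecutive ones span a
  parallelogram of area \<open>2 ^ N\<close>, and one of the two cofactors is odd.  Where the remainders cross
  \<open>2 powr (N / 2)\<close>, the first vector below has both entries at most \<open>2 powr (N / 2)\<close>.  If its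
  cofactor is even, both neighbours have odd cofactors.  As the vector itself is not too short, the
  area bounds one of these neighbours by \<open>2 powr (N / 2) / h\<close> (\<open>complexity_upper_bound\<close>).

  Almost surely \<open>1 / h\<close> grows only linearly in \<open>N\<close>, which is the logarithmic error in the exponent.
\<close>

section \<open>Fair coin sequences and prefix values\<close>

definition coin_measure :: "(nat \<Rightarrow> nat) measure" where
  "coin_measure = PiM (UNIV :: nat set) (\<lambda>_. uniform_count_measure {0, 1 :: nat})"

lemma space_coin_measure: "space coin_measure = {S. \<forall>i. S i = 0 \<or> S i = 1}"
  by (auto simp: coin_measure_def space_PiM space_uniform_count_measure PiE_def Pi_def)

interpretation coin_product:
  product_prob_space "\<lambda>_. uniform_count_measure {0, 1 :: nat}" "UNIV :: nat set"
  by (intro product_prob_spaceI prob_space_uniform_count_measure) auto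

interpretation coin: prob_space coin_measure
  unfolding coin_measure_def by (rule coin_product.prob_space_axioms)

definition prefix_value :: "(nat \<Rightarrow> nat) \<Rightarrow> nat \<Rightarrow> int" where
  "prefix_value S N = (\<Sum>i<N. int (S i) * 2 ^ i)"

lemma prefix_value_Suc: "prefix_value S (Suc N) = prefix_value S N + int (S N) * 2 ^ N"
  by (simp add: prefix_value_def)

lemma prefix_value_bounds:
  assumes "S \<in> space coin_measure"
  shows "0 \<le> prefix_value S N" "prefix_value S N < 2 ^ N"
proof (induction N)
  case (Suc N)
  case 1
  then show ?case using Suc by (simp add: prefix_value_Suc)
next
  case (Suc N)
  case 2
  have "S N = 0 \<or> S N = 1" using assms by (simp add: space_coin_measure)
  then show ?case using Suc by (auto simp: prefix_value_Suc)
qed (simp_all add: prefix_value_def)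

text \<open>
  Uniqueness of binary expansions: the value fixes the cylinder that a sequence lies in.
\<close>

lemma prefix_value_inject:
  assumes S: "S \<in> space coin_measure" and T: "T \<in> space coin_measure"
    and "prefix_value S N = prefix_value T N" and "i < N"
  shows "S i = T i"
  using assms(3,4)
proof (induction N)
  case (Suc N)
  have b: "S N = 0 \<or> S N = 1" "T N = 0 \<or> T N = 1" using S T by (simp_all add: space_coin_measure)
  have eq: "prefix_value S N + int (S N) * 2 ^ N = prefix_value T N + int (T N) * 2 ^ N"
    using Suc.prems(1) by (simp add: prefix_value_Suc)
  have top: "S N = T N"
    using b eq prefix_value_bounds[OF S, of N] prefix_value_bounds[OF T, of N] by auto
  with eq have "prefix_value S N = prefix_value T N" by simp
  with Suc top show ?case by (cases "i = N") auto
qed simp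

lemma admissible_fraction_iff:
  "admissible_fraction S N f q \<longleftrightarrow> q > 0 \<and> odd q \<and> [q * prefix_value S N = f] (mod 2 ^ N)"
  by (simp add: admissible_fraction_def prefix_value_def)

lemma rational_complexity_ge_1: "1 \<le> rational_complexity S N"
proof -
  obtain f q where "admissible_fraction S N f q" "rational_complexity S N = max \<bar>f\<bar> q"
    by (rule rational_complexity_attained)
  then show ?thesis by (auto simp: admissible_fraction_def)
qed

section \<open>The probability of small rational complexity\<close>

text \<open>
  Prescribing \<open>N\<close> fair bits costs a factor \<open>1 / 2\<close> each.  A member \<open>T\<close> of the cylinder serves as
  its name, which avoids decoding an integer into its bits.
\<close>

lemma cylinder_measure:
  assumes "T \<in> space coin_measure"
  shows "{S \<in> space coin_measure. \<forall>i<N. S i = T i} \<in> sets coin_measure"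
    and "measure coin_measure {S \<in> space coin_measure. \<forall>i<N. S i = T i} = 1 / 2 ^ N"
proof -
  let ?U = "uniform_count_measure {0, 1 :: nat}"
  have eq: "{S \<in> space coin_measure. \<forall>i<N. S i = T i}
      = prod_emb UNIV (\<lambda>_. ?U) {..<N} (PiE {..<N} (\<lambda>i. {T i}))"
    by (auto simp: prod_emb_def coin_measure_def space_PiM
        PiE_def Pi_def extensional_def restrict_def)
  have s: "{T i} \<in> sets ?U" for i
    using assms by (auto simp: sets_uniform_count_measure space_coin_measure)
  have m: "measure ?U {T i} = 1 / 2" for i
    using assms by (subst measure_uniform_count_measure) (auto simp: space_coin_measure)
  show "{S \<in> space coin_measure. \<forall>i<N. S i = T i} \<in> sets coin_measure"
    unfolding eq unfolding coin_measure_def using s by (intro sets_PiM_I) auto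
  have "measure coin_measure {S \<in> space coin_measure. \<forall>i<N. S i = T i} = (\<Prod>i<N. measure ?U {T i})"
    unfolding eq unfolding coin_measure_def using s
    by (intro coin_product.measure_PiM_emb) auto
  also have "\<dots> = 1 / 2 ^ N" by (simp only: m) (simp add: power_one_over)
  finally show "measure coin_measure {S \<in> space coin_measure. \<forall>i<N. S i = T i} = 1 / 2 ^ N" .
qed

text \<open>
  An odd \<open>q\<close> is invertible modulo \<open>2 ^ N\<close>, so \<open>q * s \<equiv> f\<close> has one solution \<open>s\<close> with
  \<open>0 \<le> s < 2 ^ N\<close>.  Hence the event is empty or a single cylinder; this also yields measurability.
\<close>

lemma admissible_event:
  fixes f q :: int and N :: nat
  defines "A \<equiv> {S \<in> space coin_measure. admissible_fraction S N f q}"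
  shows "A \<in> sets coin_measure" "measure coin_measure A \<le> 1 / 2 ^ N"
proof -
  have "A \<in> sets coin_measure \<and> measure coin_measure A \<le> 1 / 2 ^ N"
  proof (cases "A = {}")
    case False
    then obtain T where T: "T \<in> A" by auto
    then have bT: "T \<in> space coin_measure" and fT: "admissible_fraction T N f q"
      unfolding A_def by blast+
    have "A = {S \<in> space coin_measure. \<forall>i<N. S i = T i}"
    proof (intro set_eqI iffI)
      fix S assume S: "S \<in> A"
      then have bS: "S \<in> space coin_measure" and fS: "admissible_fraction S N f q"
        unfolding A_def by blast+
      have "odd q" using fS unfolding admissible_fraction_iff by blast
      then have "coprime q (2 ^ N)" by simp
      moreover have "[q * prefix_value S N = q * prefix_value T N] (mod 2 ^ N)"
        using fS fT unfolding admissible_fraction_iff by (meson cong_trans cong_sym)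
      ultimately have "[prefix_value S N = prefix_value T N] (mod 2 ^ N)"
        using cong_mult_lcancel by blast
      then have "prefix_value S N = prefix_value T N"
        using prefix_value_bounds[OF bS, of N] prefix_value_bounds[OF bT, of N]
        by (metis cong_less_imp_eq_int)
      then show "S \<in> {S \<in> space coin_measure. \<forall>i<N. S i = T i}"
        using bS prefix_value_inject[OF bS bT] by blast
    next
      fix S assume S: "S \<in> {S \<in> space coin_measure. \<forall>i<N. S i = T i}"
      then have "prefix_value S N = prefix_value T N"
        unfolding prefix_value_def by (intro sum.cong) auto
      then have "admissible_fraction S N f q" using fT unfolding admissible_fraction_iff by metis
      with S show "S \<in> A" unfolding A_def by blast
    qed
    then show ?thesis using cylinder_measure[OF bT, of N] by (simp only: order_refl simp_thms)
  qed simp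
  then show "A \<in> sets coin_measure" "measure coin_measure A \<le> 1 / 2 ^ N" by auto
qed

lemma rational_complexity_le_iff:
  "rational_complexity S N \<le> K \<longleftrightarrow>
     (\<exists>f\<in>{-K..K}. \<exists>q\<in>{1..K}. admissible_fraction S N f q)"
proof
  assume K: "rational_complexity S N \<le> K"
  obtain f q where fq: "admissible_fraction S N f q" "rational_complexity S N = max \<bar>f\<bar> q"
    by (rule rational_complexity_attained)
  then have "f \<in> {-K..K}" "q \<in> {1..K}" using K by (auto simp: admissible_fraction_def)
  with fq(1) show "\<exists>f\<in>{-K..K}. \<exists>q\<in>{1..K}. admissible_fraction S N f q" by blast
next
  assume "\<exists>f\<in>{-K..K}. \<exists>q\<in>{1..K}. admissible_fraction S N f q"
  then obtain f q where "f \<in> {-K..K}" "q \<in> {1..K}" "admissible_fraction S N f q" by blast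
  with rational_complexity_le(1)[of S N f q] show "rational_complexity S N \<le> K" by auto
qed

text \<open>
  Union bound over the \<open>(2 * K + 1) * K \<le> 3 * K\<^sup>2\<close> candidate pairs \<open>(f, q)\<close>.
\<close>

lemma small_complexity_event:
  fixes K :: int and N :: nat
  assumes "0 \<le> K"
  defines "E \<equiv> {S \<in> space coin_measure. rational_complexity S N \<le> K}"
  shows "E \<in> sets coin_measure" "measure coin_measure E \<le> 3 * (real_of_int K)\<^sup>2 / 2 ^ N"
proof -
  define A where "A p = {S \<in> space coin_measure. admissible_fraction S N (fst p) (snd p)}" for p
  define I where "I = {-K..K} \<times> {1..K}"
  have fin: "finite I" by (simp add: I_def)
  have E: "E = (\<Union>p\<in>I. A p)"
  proof (intro set_eqI iffI)
    fix S assume "S \<in> E"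
    then obtain f q where "S \<in> space coin_measure" "f \<in> {-K..K}" "q \<in> {1..K}"
        "admissible_fraction S N f q"
      unfolding E_def rational_complexity_le_iff by blast
    then have "(f, q) \<in> I" "S \<in> A (f, q)" by (simp_all add: A_def I_def)
    then show "S \<in> (\<Union>p\<in>I. A p)" by blast
  next
    fix S assume "S \<in> (\<Union>p\<in>I. A p)"
    then obtain f q where "(f, q) \<in> I" "S \<in> A (f, q)" by force
    then have "S \<in> space coin_measure" "f \<in> {-K..K}" "q \<in> {1..K}" "admissible_fraction S N f q"
      by (simp_all add: A_def I_def)
    then show "S \<in> E" unfolding E_def rational_complexity_le_iff by blast
  qed
  have A: "A p \<in> sets coin_measure" "measure coin_measure (A p) \<le> 1 / 2 ^ N" for p
    unfolding A_def by (rule admissible_event)+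
  show "E \<in> sets coin_measure" unfolding E using fin A(1) by blast
  have card: "real (card I) = (2 * real_of_int K + 1) * real_of_int K"
    using assms(1) by (simp add: I_def card_cartesian_product)
  have "real_of_int K * 1 \<le> real_of_int K * real_of_int K"
    using assms(1) by (cases "K = 0") (auto intro: mult_left_mono)
  then have le: "real (card I) \<le> 3 * (real_of_int K)\<^sup>2"
    unfolding card by (simp add: power2_eq_square algebra_simps)
  have "measure coin_measure E \<le> (\<Sum>p\<in>I. measure coin_measure (A p))"
    unfolding E using fin A(1) by (intro coin.finite_measure_subadditive_finite) auto
  also have "\<dots> \<le> (\<Sum>p\<in>I. 1 / 2 ^ N)" by (intro sum_mono A(2))
  also have "\<dots> = real (card I) / 2 ^ N" by simp
  also have "\<dots> \<le> 3 * (real_of_int K)\<^sup>2 / 2 ^ N" using le by (intro divide_right_mono) auto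
  finally show "measure coin_measure E \<le> 3 * (real_of_int K)\<^sup>2 / 2 ^ N" .
qed

text \<open>
  The threshold is chosen so that the union bound gives \<open>3 / N\<^sup>2\<close>, a convergent series for the
  Borel-Cantelli lemma.
\<close>

lemma AE_eventually_complexity_large:
  "AE S in coin_measure. \<forall>\<^sub>F N in sequentially.
     2 powr (real N / 2) / real N < real_of_int (rational_complexity S N)"
proof -
  define K :: "nat \<Rightarrow> int" where "K N = \<lfloor>2 powr (real N / 2) / real N\<rfloor>" for N
  define E where "E N = {S \<in> space coin_measure. rational_complexity S N \<le> K N}" for N
  have K0: "0 \<le> K N" for N by (simp add: K_def)
  have E: "E N \<in> sets coin_measure" for N
    unfolding E_def by (rule small_complexity_event(1)[OF K0])
  have bound: "measure coin_measure (E N) \<le> 3 * (1 / real N ^ 2)" for N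
  proof -
    have "real_of_int (K N) \<le> 2 powr (real N / 2) / real N" unfolding K_def by simp
    then have "(real_of_int (K N))\<^sup>2 \<le> (2 powr (real N / 2) / real N)\<^sup>2"
      using K0[of N] by (intro power_mono) auto
    also have "\<dots> = 2 ^ N / (real N)\<^sup>2"
      by (simp add: power_divide powr_realpow[symmetric] powr_powr)
    finally have "3 * (real_of_int (K N))\<^sup>2 / 2 ^ N \<le> 3 * (2 ^ N / (real N)\<^sup>2) / 2 ^ N"
      by (intro divide_right_mono mult_left_mono) auto
    then show ?thesis
      using small_complexity_event(2)[OF K0[of N], of N] by (simp add: E_def)
  qed
  have "summable (\<lambda>N. measure coin_measure (E N))"
  proof (rule summable_comparison_test')
    show "summable (\<lambda>N. 3 * (1 / real N ^ 2))"
      using inverse_power_summable[of 2, where 'a = real]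
      by (intro summable_mult) (simp add: inverse_eq_divide)
    show "norm (measure coin_measure (E N)) \<le> 3 * (1 / real N ^ 2)" if "N \<ge> 0" for N
      using bound[of N] by simp
  qed
  then have "AE S in coin_measure. \<forall>\<^sub>F N in sequentially. S \<in> space coin_measure - E N"
    using E by (intro borel_cantelli_AE1) (auto simp: coin.emeasure_eq_measure)
  then show ?thesis
  proof (rule AE_mp, intro AE_I2 impI)
    fix S assume "\<forall>\<^sub>F N in sequentially. S \<in> space coin_measure - E N"
    then show "\<forall>\<^sub>F N in sequentially.
        2 powr (real N / 2) / real N < real_of_int (rational_complexity S N)"
      by eventually_elim (auto simp: E_def K_def not_le floor_less_iff)
  qed
qed

text \<open>
  The finitely many small lengths are absorbed by the constant factor \<open>2 ^ n0\<close>, because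
  \<open>\<Lambda>(N) \<ge> 1 \<ge> 2 powr (N / 2) / 2 ^ n0\<close> for \<open>N \<le> n0\<close>.  The denominator \<open>N + 1\<close> makes the bound
  meaningful at \<open>N = 0\<close> as well.
\<close>

lemma complexity_lower_bound_all:
  assumes "\<And>N. N \<ge> n0 \<Longrightarrow> 2 powr (real N / 2) / real N < real_of_int (rational_complexity S N)"
  shows "2 powr (real N / 2) / (2 ^ n0 * (real N + 1)) \<le> real_of_int (rational_complexity S N)"
proof (cases "N \<ge> n0 \<and> N > 0")
  case True
  have "1 * real N \<le> 2 ^ n0 * (real N + 1)" by (intro mult_mono) auto
  then have "2 powr (real N / 2) / (2 ^ n0 * (real N + 1)) \<le> 2 powr (real N / 2) / real N"
    using True by (intro divide_left_mono) auto
  also have "\<dots> \<le> real_of_int (rational_complexity S N)" using assms True less_imp_le by blast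
  finally show ?thesis .
next
  case False
  then have "N \<le> n0" by auto
  then have "2 powr (real N / 2) \<le> (2::real) powr real n0" by (intro powr_mono) auto
  also have "\<dots> = 2 ^ n0 * 1" by (simp add: powr_realpow)
  also have "\<dots> \<le> 2 ^ n0 * (real N + 1)" by (intro mult_left_mono) auto
  finally have "2 powr (real N / 2) / (2 ^ n0 * (real N + 1)) \<le> 1" by simp
  also have "\<dots> \<le> real_of_int (rational_complexity S N)" using rational_complexity_ge_1[of S N] by simp
  finally show ?thesis .
qed

section \<open>From lower bounds to an upper bound\<close>

text \<open>
  Here \<open>q\<close> may be even.  Then \<open>f\<close> is even too, and halving both gives a fraction for the prefix of
  length \<open>N - 1\<close>.  The size drops by a factor \<open>2\<close> whereas the bound drops only by \<open>sqrt 2\<close>, so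
  induction on the length works.
\<close>

lemma fraction_lower_bound:
  assumes "h \<le> 1" "0 \<le> h"
    and "\<And>n. n \<le> N \<Longrightarrow> h * 2 powr (real n / 2) \<le> real_of_int (rational_complexity S n)"
    and "q > 0" and "[q * prefix_value S N = f] (mod 2 ^ N)"
  shows "h * 2 powr (real N / 2) \<le> real_of_int (max \<bar>f\<bar> q)"
  using assms(3-5)
proof (induction N arbitrary: f q)
  case 0
  then have "1 \<le> max \<bar>f\<bar> q" by auto
  then have "1 \<le> real_of_int (max \<bar>f\<bar> q)" by linarith
  then show ?case using assms(1) by simp
next
  case (Suc N)
  show ?case
  proof (cases "odd q")
    case True
    then have "rational_complexity S (Suc N) \<le> max \<bar>f\<bar> q"
      using Suc.prems by (intro rational_complexity_le) (simp add: admissible_fraction_iff)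
    then have "real_of_int (rational_complexity S (Suc N)) \<le> real_of_int (max \<bar>f\<bar> q)"
      by linarith
    then show ?thesis using Suc.prems(1)[of "Suc N"] by linarith
  next
    case False
    then obtain q' where q: "q = 2 * q'" by (auto elim: evenE)
    have dvd: "2 ^ Suc N dvd q * prefix_value S (Suc N) - f"
      using Suc.prems(3) by (simp add: cong_iff_dvd_diff)
    then have "even (q * prefix_value S (Suc N) - f)"
      by (rule dvd_trans[rotated]) simp
    then have "even f" using q by simp
    then obtain f' where f: "f = 2 * f'" by (auto elim: evenE)
    have "2 * 2 ^ N dvd 2 * (q' * prefix_value S (Suc N) - f')"
      using dvd by (simp add: q f algebra_simps)
    then have "2 ^ N dvd q' * prefix_value S (Suc N) - f'"
      by (subst (asm) dvd_mult_cancel_left) simp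
    then have "2 ^ N dvd (q' * prefix_value S (Suc N) - f') - q' * int (S N) * 2 ^ N"
      by (rule dvd_diff) simp
    then have "[q' * prefix_value S N = f'] (mod 2 ^ N)"
      by (simp add: cong_iff_dvd_diff prefix_value_Suc algebra_simps)
    then have IH: "h * 2 powr (real N / 2) \<le> real_of_int (max \<bar>f'\<bar> q')"
      using Suc.prems q by (intro Suc.IH) auto
    have "h * 2 powr (real (Suc N) / 2) \<le> h * 2 powr (real N / 2 + 1)"
      using assms(2) by (intro mult_left_mono powr_mono) auto
    also have "\<dots> = 2 * (h * 2 powr (real N / 2))" by (simp add: powr_add)
    also have "\<dots> \<le> real_of_int (2 * max \<bar>f'\<bar> q')" using IH by simp
    also have "2 * max \<bar>f'\<bar> q' = max \<bar>f\<bar> q" by (auto simp: q f)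
    finally show ?thesis .
  qed
qed

text \<open>
  Two consecutive rows of the extended Euclidean algorithm on \<open>M\<close> and \<open>s\<close>: remainders \<open>a \<ge> b\<close> with
  the absolute values \<open>x \<le> y\<close> of the cofactors of \<open>s\<close>.  The signs of the cofactors alternate, and
  \<open>e\<close> is the sign of the earlier one; thus \<open>a * y + b * x\<close> is the absolute value of the determinant
  of the two rows.
\<close>

definition euclid_state :: "int \<Rightarrow> int \<Rightarrow> int \<Rightarrow> int \<Rightarrow> int \<Rightarrow> int \<Rightarrow> bool" where
  "euclid_state M s a x b y \<longleftrightarrow>
     0 \<le> b \<and> b \<le> a \<and> 0 \<le> x \<and> x \<le> y \<and> 0 < y \<and> (odd x \<or> odd y) \<and> a * y + b * x = M \<and>
     (\<exists>e\<in>{1, -1}. [x * s = e * a] (mod M) \<and> [y * s = - (e * b)] (mod M))"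

text \<open>
  One division step is a unimodular change of the two rows: it preserves the determinant, and it
  keeps the cofactors from being both even.
\<close>

lemma euclid_state_step:
  assumes "euclid_state M s a x b y" "0 < b"
  shows "euclid_state M s b y (a mod b) (x + (a div b) * y)"
proof -
  define k where "k = a div b"
  have r: "a mod b = a - k * b" by (simp add: k_def minus_div_mult_eq_mod)
  have ab: "0 \<le> b" "b \<le> a" "0 \<le> x" "x \<le> y" "0 < y" "odd x \<or> odd y" "a * y + b * x = M"
    using assms(1) by (auto simp: euclid_state_def)
  have "1 \<le> k" using ab assms(2) unfolding k_def by (simp add: pos_imp_zdiv_pos_iff int_one_le_iff_zero_less)
  then have ky: "1 * y \<le> k * y" using ab by (intro mult_right_mono) auto
  have mod: "0 \<le> a mod b" "a mod b \<le> b" using assms(2) by (auto simp: less_imp_le)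
  have det: "b * (x + k * y) + (a - k * b) * y = M" using ab(7) by (simp add: algebra_simps)
  obtain e where e: "e \<in> {1, -1}" "[x * s = e * a] (mod M)" "[y * s = - (e * b)] (mod M)"
    using assms(1) unfolding euclid_state_def by blast
  have "[x * s + k * (y * s) = e * a + k * (- (e * b))] (mod M)"
    by (rule cong_add[OF e(2) cong_scalar_left[OF e(3)]])
  then have "[(x + k * y) * s = - ((- e) * (a - k * b))] (mod M)"
    by (simp add: algebra_simps)
  moreover have "[y * s = (- e) * b] (mod M)" "- e \<in> {1, -1}" using e by auto
  ultimately have "\<exists>e\<in>{1, -1}. [y * s = e * b] (mod M) \<and> [(x + k * y) * s = - (e * (a - k * b))] (mod M)"
    by blast
  moreover have "odd y \<or> odd (x + k * y)" using ab(6) by auto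
  ultimately show ?thesis
    using ab ky mod det unfolding euclid_state_def k_def[symmetric] r by (intro conjI) linarith+
qed

lemma euclid_state_crossing:
  fixes T :: real
  assumes "euclid_state M s a x b y" "T \<le> real_of_int a" "0 < T"
  shows "\<exists>a x b y. euclid_state M s a x b y \<and> real_of_int b < T \<and> T \<le> real_of_int a"
  using assms
proof (induction "nat b" arbitrary: a x b y rule: less_induct)
  case less
  show ?case
  proof (cases "real_of_int b < T")
    case False
    then have "0 < b" using less.prems(3) by linarith
    then have "nat (a mod b) < nat b" by simp
    moreover have "T \<le> real_of_int b" using False by simp
    ultimately show ?thesis
      using less.hyps euclid_state_step[OF less.prems(1) \<open>0 < b\<close>] less.prems(3) by blast
  qed (use less.prems in blast)
qed

lemma euclid_state_admissible:
  assumes "euclid_state (2 ^ N) (prefix_value S N) a x b y"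
  shows "odd x \<Longrightarrow> rational_complexity S N \<le> max a x"
    and "odd y \<Longrightarrow> rational_complexity S N \<le> max b y"
proof -
  obtain e where st: "0 \<le> b" "b \<le> a" "0 \<le> x" "0 < y" "e = 1 \<or> e = -1"
      "[x * prefix_value S N = e * a] (mod 2 ^ N)" "[y * prefix_value S N = - (e * b)] (mod 2 ^ N)"
    using assms unfolding euclid_state_def by blast
  show "rational_complexity S N \<le> max a x" if "odd x"
  proof -
    have "x \<noteq> 0" using that by auto
    then have "admissible_fraction S N (e * a) x"
      using st that by (simp add: admissible_fraction_iff)
    from rational_complexity_le(1)[OF this] show ?thesis using st by auto
  qed
  show "rational_complexity S N \<le> max b y" if "odd y"
  proof -
    have "admissible_fraction S N (- (e * b)) y"
      using st that by (simp add: admissible_fraction_iff)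
    from rational_complexity_le(1)[OF this] show ?thesis using st by auto
  qed
qed

text \<open>
  Let \<open>T = 2 powr (N / 2)\<close> and stop the algorithm where \<open>a \<ge> T > b\<close>.  From \<open>a * y \<le> T\<^sup>2\<close> it
  follows that \<open>y \<le> T\<close>, so an odd \<open>y\<close> gives \<open>\<Lambda>(N) \<le> T\<close>.  Otherwise \<open>fraction_lower_bound\<close>,
  applied to the row \<open>(b, y)\<close> with its even \<open>y\<close>, leaves two cases.  If \<open>y \<ge> h * T\<close>, then
  \<open>a * y \<le> T\<^sup>2\<close> gives \<open>a \<le> T / h\<close> and the previous row \<open>(a, x)\<close> is good.  If \<open>b \<ge> h * T\<close>, then
  the next cofactor \<open>z\<close> satisfies \<open>b * z \<le> T\<^sup>2\<close>, so \<open>z \<le> T / h\<close> and the next row is good.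
\<close>

lemma complexity_upper_bound:
  assumes "0 < h" "h \<le> 1"
    and "\<And>n. n \<le> N \<Longrightarrow> h * 2 powr (real n / 2) \<le> real_of_int (rational_complexity S n)"
  shows "real_of_int (rational_complexity S N) \<le> 2 powr (real N / 2) / h"
proof -
  define s where "s = prefix_value S N"
  define T where "T = 2 powr (real N / 2)"
  have T: "0 < T" "T * T = 2 ^ N" "T \<le> 2 ^ N"
    by (auto simp: T_def powr_realpow[symmetric] powr_add[symmetric] intro: powr_mono)
  have Th: "T \<le> T / h" using assms(1,2) T(1) by (simp add: field_simps)
  have "euclid_state (2 ^ N) s (2 ^ N) 0 (s mod 2 ^ N) 1"
    unfolding euclid_state_def
    \<comment> \<open>The first cofactor is \<open>0\<close>; it has to be given the sign opposite to that of \<open>1\<close>.\<close>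
    by (auto simp: cong_def less_imp_le intro!: bexI[of _ "-1"])
  then obtain a x b y where st: "euclid_state (2 ^ N) s a x b y" and bT: "real_of_int b < T"
      and aT: "T \<le> real_of_int a"
    using euclid_state_crossing[of "2 ^ N" s "2 ^ N" 0 "s mod 2 ^ N" 1 T] T by auto
  have ab: "0 \<le> b" "b \<le> a" "0 \<le> x" "x \<le> y" "0 < y" "odd x \<or> odd y"
    and det: "a * y + b * x = 2 ^ N"
    using st by (auto simp: euclid_state_def)
  have "a * y \<le> 2 ^ N" using det ab by (smt (verit) mult_nonneg_nonneg)
  then have "real_of_int (a * y) \<le> real_of_int (2 ^ N)" by (rule of_int_le_iff[THEN iffD2])
  then have ay: "real_of_int a * real_of_int y \<le> T * T" using T by simp
  have yT: "real_of_int y \<le> T"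
  proof -
    have "T * real_of_int y \<le> real_of_int a * real_of_int y" using aT ab by (intro mult_right_mono) auto
    then have "T * real_of_int y \<le> T * T" using ay by linarith
    then show ?thesis using T(1) by simp
  qed
  show ?thesis
  proof (cases "odd y")
    case True
    then have "rational_complexity S N \<le> max b y"
      using euclid_state_admissible(2) st s_def by blast
    then show ?thesis using bT yT Th unfolding T_def by linarith
  next
    case False
    then have "odd x" using ab by blast
    obtain e where e: "e = 1 \<or> e = -1" "[y * s = - (e * b)] (mod 2 ^ N)"
      using st unfolding euclid_state_def by blast
    have "h * T \<le> real_of_int (max \<bar>- (e * b)\<bar> y)"
      unfolding T_def using assms ab(5) e(2) by (intro fraction_lower_bound) (auto simp: s_def)
    also have "max \<bar>- (e * b)\<bar> y = max b y" using e(1) ab(1) by auto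
    finally have "h * T \<le> real_of_int b \<or> h * T \<le> real_of_int y" by (auto simp: max_def split: if_splits)
    then show ?thesis
    proof
      assume y: "h * T \<le> real_of_int y"
      have "real_of_int a * (h * T) \<le> real_of_int a * real_of_int y"
        using y ab by (intro mult_left_mono) auto
      then have "(real_of_int a * h) * T \<le> T * T" using ay by (simp add: mult.assoc)
      then have "real_of_int a \<le> T / h" using T(1) assms(1) by (simp add: field_simps)
      moreover have "rational_complexity S N \<le> max a x"
        using euclid_state_admissible(1) st s_def \<open>odd x\<close> by blast
      ultimately show ?thesis using yT Th ab(4) unfolding T_def by linarith
    next
      assume b: "h * T \<le> real_of_int b"
      then have b0: "0 < b" using T(1) assms(1) by (smt (verit) mult_pos_pos of_int_0_less_iff)
      define z where "z = x + (a div b) * y"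
      have st': "euclid_state (2 ^ N) s b y (a mod b) z"
        unfolding z_def by (rule euclid_state_step[OF st b0])
      then have z: "odd z" "0 < z" "b * z + a mod b * y = 2 ^ N"
        using False by (auto simp: euclid_state_def)
      have "b * z \<le> 2 ^ N" using z ab b0 by (smt (verit) mult_nonneg_nonneg pos_mod_sign)
      then have "real_of_int (b * z) \<le> real_of_int (2 ^ N)" by (rule of_int_le_iff[THEN iffD2])
      moreover have "(h * T) * real_of_int z \<le> real_of_int b * real_of_int z"
        using b z by (intro mult_right_mono) auto
      ultimately have "(real_of_int z * h) * T \<le> T * T" using T by (simp add: mult_ac)
      then have "real_of_int z \<le> T / h" using T(1) assms(1) by (simp add: field_simps)
      moreover have "rational_complexity S N \<le> max (a mod b) z"
        using euclid_state_admissible(2) st' s_def z(1) by blast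
      moreover have "a mod b < b" using b0 by simp
      ultimately show ?thesis using bT Th unfolding T_def by linarith
    qed
  qed
qed

section \<open>Almost sure growth\<close>

text \<open>
  The loss factor \<open>2 ^ n0 * (N + 1)\<close> is at most \<open>N ^ (n0 + 2)\<close> for \<open>N \<ge> 2\<close>, and \<open>C\<close> is chosen such
  that this power is \<open>2 powr (C * ln N)\<close>.
\<close>

lemma complexity_log_bounds:
  assumes low: "\<And>N. 2 powr (real N / 2) / (2 ^ n0 * (real N + 1)) \<le> real_of_int (rational_complexity S N)"
    and "N \<ge> 2"
  defines "C \<equiv> (real n0 + 2) / ln 2"
  shows "2 powr (real N / 2 - C * ln (real N)) \<le> real_of_int (rational_complexity S N)"
    and "real_of_int (rational_complexity S N) \<le> 2 powr (real N / 2 + C * ln (real N))"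
    and "\<bar>two_adic_complexity S N - real N / 2\<bar> \<le> C * ln (real N)"
proof -
  define h where "h = 1 / (2 ^ n0 * (real N + 1))"
  have D: "1 \<le> 2 ^ n0 * (real N + 1)"
    using mult_mono[of 1 "2 ^ n0 :: real" 1 "real N + 1"] by simp
  have h: "0 < h" "h \<le> 1" using D by (auto simp: h_def)
  have lowh: "h * 2 powr (real n / 2) \<le> real_of_int (rational_complexity S n)" if "n \<le> N" for n
  proof -
    have "h * 2 powr (real n / 2) \<le> 2 powr (real n / 2) / (2 ^ n0 * (real n + 1))"
      unfolding h_def using that by (auto intro!: divide_left_mono mult_left_mono)
    then show ?thesis using low[of n] by linarith
  qed
  have pw: "2 powr (C * ln (real N)) = real N ^ (n0 + 2)"
  proof -
    have "2 powr (C * ln (real N)) = exp (real (n0 + 2) * ln (real N))"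
      by (simp add: powr_def C_def)
    also have "\<dots> = real N ^ (n0 + 2)"
      unfolding exp_of_nat_mult using assms(2) by simp
    finally show ?thesis .
  qed
  have "real N + 1 \<le> 2 * real N" using assms(2) by simp
  also have "\<dots> \<le> real N * real N" using assms(2) by (intro mult_right_mono) auto
  finally have "2 ^ n0 * (real N + 1) \<le> real N ^ n0 * real N ^ 2"
    using assms(2) by (intro mult_mono power_mono) (auto simp: power2_eq_square)
  then have hC: "1 / h \<le> 2 powr (C * ln (real N))" unfolding pw h_def power_add by simp
  then have hC': "2 powr (- (C * ln (real N))) \<le> h"
    using h(1) by (simp add: powr_minus field_simps)
  show lo: "2 powr (real N / 2 - C * ln (real N)) \<le> real_of_int (rational_complexity S N)"
  proof -
    have "2 powr (real N / 2 - C * ln (real N)) = 2 powr (- (C * ln (real N))) * 2 powr (real N / 2)"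
      by (simp flip: powr_add)
    also have "\<dots> \<le> h * 2 powr (real N / 2)" using hC' by (intro mult_right_mono) auto
    finally show ?thesis using lowh[of N] by simp
  qed
  show up: "real_of_int (rational_complexity S N) \<le> 2 powr (real N / 2 + C * ln (real N))"
  proof -
    have "real_of_int (rational_complexity S N) \<le> 2 powr (real N / 2) * (1 / h)"
      using complexity_upper_bound[OF h lowh] by simp
    also have "\<dots> \<le> 2 powr (real N / 2) * 2 powr (C * ln (real N))"
      using hC by (intro mult_left_mono) auto
    finally show ?thesis by (simp flip: powr_add)
  qed
  have pos: "0 < real_of_int (rational_complexity S N)" using rational_complexity_ge_1[of S N] by simp
  have "real N / 2 - C * ln (real N) \<le> two_adic_complexity S N"
    unfolding two_adic_complexity_def using lo pos by (simp add: le_log_iff)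
  moreover have "two_adic_complexity S N \<le> real N / 2 + C * ln (real N)"
    unfolding two_adic_complexity_def using up pos by (simp add: log_le_iff)
  ultimately show "\<bar>two_adic_complexity S N - real N / 2\<bar> \<le> C * ln (real N)" by linarith
qed

theorem theorem4:
  shows "AE S in binary_sequence_measure. \<exists>C>0. \<forall>N\<ge>2.
           \<bar>two_adic_complexity S N - real N / 2\<bar> \<le> C * ln (real N) \<and>
           2 powr (real N / 2 - C * ln (real N)) \<le> real_of_int (rational_complexity S N) \<and>
           real_of_int (rational_complexity S N) \<le> 2 powr (real N / 2 + C * ln (real N))"
  unfolding binary_sequence_measure_def coin_measure_def[symmetric]
proof (rule AE_completion, rule AE_mp[OF AE_eventually_complexity_large], intro AE_I2 impI)
  fix S
  assume "\<forall>\<^sub>F N in sequentially. 2 powr (real N / 2) / real N < real_of_int (rational_complexity S N)"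
  then obtain n0 where
    "\<And>N. N \<ge> n0 \<Longrightarrow> 2 powr (real N / 2) / real N < real_of_int (rational_complexity S N)"
    by (auto simp: eventually_sequentially)
  then have low:
    "2 powr (real N / 2) / (2 ^ n0 * (real N + 1)) \<le> real_of_int (rational_complexity S N)" for N
    by (rule complexity_lower_bound_all)
  have "0 < (real n0 + 2) / ln 2" by (simp add: add_nonneg_pos)
  then show "\<exists>C>0. \<forall>N\<ge>2.
           \<bar>two_adic_complexity S N - real N / 2\<bar> \<le> C * ln (real N) \<and>
           2 powr (real N / 2 - C * ln (real N)) \<le> real_of_int (rational_complexity S N) \<and>
           real_of_int (rational_complexity S N) \<le> 2 powr (real N / 2 + C * ln (real N))"
    using complexity_log_bounds[OF low] by blast
qed

end
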